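(* For every countable subgroup $K$ of $\mathbb R/\mathbb Z$ and for every subgroup $H_0\le\mathrm{Homeo}_+(I)$ there is an embedding (injective group homomorphism) $H_0\wr K\hookrightarrow\mathrm{Homeo}_+(S^1)$.
   Context: $I=[0,1]$ and $S^1=\mathbb R/\mathbb Z$; $\mathrm{Homeo}_+(I)$ and $\mathrm{Homeo}_+(S^1)$ are the groups of all orientation-preserving homeomorphisms of $I$ and of $S^1$. For groups $C,T$, $C\wr T\cong\left(\prod_{t\in T}C\right)\rtimes T$ denotes the unrestricted standard wreath product. Countable includes finite. *)

theory Defs
  imports "HOL-Analysis.Analysis" "HOL-Algebra.Algebra"
begin

definition real_group :: "real monoid"
  where "real_group = \<lparr>carrier = UNIV, monoid.mult = (+), one = 0\<rparr>"

definition circle_group :: "real set monoid"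
  where "circle_group = real_group Mod \<int>"

definition circle_proj :: "real \<Rightarrow> real set"
  where "circle_proj x = \<int> #>\<^bsub>real_group\<^esub> x"

text \<open>The quotient topology of \<open>\<real>/\<int>\<close>; see \<open>quotient_map_circle_proj\<close>.\<close>

definition circle_topology :: "real set topology"
  where "circle_topology =
    topology (\<lambda>U. U \<subseteq> carrier circle_group \<and> open (circle_proj -` U))"

text \<open>As in \<open>BijGroup\<close>, self-maps are extensional, i.e. \<open>undefined\<close> off the underlying space.\<close>

definition homeo_plus_interval :: "(real \<Rightarrow> real) monoid"
  where "homeo_plus_interval = (BijGroup {0..1})
    \<lparr>carrier := {f \<in> Bij {0..1}.
       homeomorphic_map (top_of_set {0..1}) (top_of_set {0..1}) f \<and> strict_mono_on {0..1} f}\<rparr>"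

text \<open>A homeomorphism of \<open>\<real>/\<int>\<close> preserves orientation iff it lifts to an increasing
  homeomorphism of the universal cover \<open>\<real>\<close>.\<close>

definition homeo_plus_circle :: "(real set \<Rightarrow> real set) monoid"
  where "homeo_plus_circle = (BijGroup (carrier circle_group))
    \<lparr>carrier := {f \<in> Bij (carrier circle_group).
       homeomorphic_map circle_topology circle_topology f \<and>
       (\<exists>F :: real \<Rightarrow> real. homeomorphic_map euclidean euclidean F \<and> strict_mono F \<and>
          (\<forall>x. f (circle_proj x) = circle_proj (F x)))}\<rparr>"

definition semidirect_product ::
    "('a, 'c) monoid_scheme \<Rightarrow> ('b, 'd) monoid_scheme \<Rightarrow> ('b \<Rightarrow> 'a \<Rightarrow> 'a) \<Rightarrow> ('a \<times> 'b) monoid"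
  where "semidirect_product N T \<alpha> =
    \<lparr>carrier = carrier N \<times> carrier T,
     monoid.mult = (\<lambda>(n, s) (m, t). (n \<otimes>\<^bsub>N\<^esub> \<alpha> s m, s \<otimes>\<^bsub>T\<^esub> t)),
     one = (\<one>\<^bsub>N\<^esub>, \<one>\<^bsub>T\<^esub>)\<rparr>"

text \<open>\<open>T\<close> acts on \<open>\<Prod>\<^bsub>t\<in>T\<^esub> C\<close> through its left regular action on the index set.\<close>

definition wreath_product ::
    "('a, 'c) monoid_scheme \<Rightarrow> ('b, 'd) monoid_scheme \<Rightarrow> (('b \<Rightarrow> 'a) \<times> 'b) monoid"
  where "wreath_product C T =
    semidirect_product (product_group (carrier T) (\<lambda>_. C)) T
      (\<lambda>s \<phi>. \<lambda>u\<in>carrier T. \<phi> (inv\<^bsub>T\<^esub> s \<otimes>\<^bsub>T\<^esub> u))"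

lemma group_real_group: "group real_group"
  unfolding real_group_def by (rule groupI) (auto simp: add.assoc intro: exI[of _ "- _"] add.left_inverse)

lemma inv_real_group: "inv\<^bsub>real_group\<^esub> x = - x"
  by (rule group.inv_equality[OF group_real_group]) (auto simp: real_group_def)

lemma comm_group_real_group: "comm_group real_group"
  by (rule group.group_comm_groupI[OF group_real_group]) (auto simp: real_group_def)

lemma normal_Ints: "\<int> \<lhd> real_group"
proof -
  have "subgroup \<int> real_group"
    by (rule group.subgroupI[OF group_real_group]) (auto simp: inv_real_group, auto simp: real_group_def)
  thus ?thesis by (rule comm_group.normal_iff_subgroup[OF comm_group_real_group, THEN iffD2])
qed

lemma group_circle_group: "group circle_group"
  unfolding circle_group_def by (rule normal.factorgroup_is_group[OF normal_Ints])

lemma carrier_circle_group: "carrier circle_group = range circle_proj"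
  by (auto simp: circle_group_def FactGroup_def RCOSETS_def circle_proj_def real_group_def)

lemma openin_circle_topology:
  "openin circle_topology U \<longleftrightarrow> U \<subseteq> carrier circle_group \<and> open (circle_proj -` U)"
proof -
  have "istopology (\<lambda>U. U \<subseteq> carrier circle_group \<and> open (circle_proj -` U))"
    unfolding istopology_def by (auto simp: vimage_Union)
  thus ?thesis by (simp add: circle_topology_def topology_inverse')
qed

lemma topspace_circle_topology: "topspace circle_topology = carrier circle_group"
proof -
  have "circle_proj -` carrier circle_group = UNIV" by (auto simp: carrier_circle_group)
  hence "openin circle_topology (carrier circle_group)" by (simp add: openin_circle_topology)
  thus ?thesis
    by (meson openin_circle_topology openin_subset openin_topspace subset_antisym)
qed

lemma quotient_map_circle_proj: "quotient_map euclidean circle_topology circle_proj"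
  by (auto simp: quotient_map_def topspace_circle_topology carrier_circle_group
        openin_circle_topology vimage_def)

lemma group_homeo_plus_interval: "group homeo_plus_interval"
proof -
  let ?I = "{0..1::real}"
  let ?X = "top_of_set ?I"
  interpret B: group "BijGroup ?I" by (rule group_BijGroup)
  have "subgroup {f \<in> Bij ?I. homeomorphic_map ?X ?X f \<and> strict_mono_on ?I f} (BijGroup ?I)"
    (is "subgroup ?H _")
  proof (rule B.subgroupI)
    show "?H \<subseteq> carrier (BijGroup ?I)" by (auto simp: BijGroup_def)
    have "homeomorphic_map ?X ?X (\<lambda>x\<in>?I. x)"
      by (rule homeomorphic_map_eq[of _ _ id]) auto
    hence "(\<lambda>x\<in>?I. x) \<in> ?H" by (auto simp: id_Bij strict_mono_on_def)
    thus "?H \<noteq> {}" by blast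
  next
    fix f assume f: "f \<in> ?H"
    let ?g = "\<lambda>x\<in>?I. inv_into ?I f x"
    from f have bij: "bij_betw f ?I ?I" by (simp add: Bij_def)
    from f obtain g where g: "homeomorphic_maps ?X ?X f g" by (auto simp: homeomorphic_map_maps)
    hence "homeomorphic_map ?X ?X g" by (metis homeomorphic_maps_map)
    moreover have "g x = ?g x" if "x \<in> ?I" for x
    proof -
      have "inj_on f ?I" "g x \<in> ?I" "f (g x) = x"
        using g that bij by (auto simp: homeomorphic_maps_def continuous_map_def Pi_iff bij_betw_def)
      hence "inv_into ?I f x = g x" by (rule inv_into_f_eq)
      thus ?thesis using that by simp
    qed
    ultimately have hg: "homeomorphic_map ?X ?X ?g"
      by (metis homeomorphic_map_eq topspace_euclidean_subtopology)
    have "strict_mono_on ?I ?g"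
    proof (rule strict_mono_onI)
      fix x y assume xy: "x \<in> ?I" "y \<in> ?I" "x < y"
      have s: "?g x \<in> ?I" "?g y \<in> ?I" "f (?g x) = x" "f (?g y) = y"
        using xy bij_betw_apply[OF bij_betw_inv_into[OF bij]] bij_betw_inv_into_right[OF bij] by simp_all
      have mono: "strict_mono_on ?I f" using f by simp
      show "?g x < ?g y"
      proof (rule ccontr)
        assume "\<not> ?g x < ?g y"
        hence "?g y < ?g x \<or> ?g y = ?g x" by linarith
        hence "f (?g y) \<le> f (?g x)" using strict_mono_onD[OF mono s(2,1)] by auto
        thus False using s(3,4) xy(3) by linarith
      qed
    qed
    with hg f show "inv\<^bsub>BijGroup ?I\<^esub> f \<in> ?H"
      by (simp add: inv_BijGroup restrict_inv_into_Bij)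
  next
    fix f g assume fg: "f \<in> ?H" "g \<in> ?H"
    have "homeomorphic_map ?X ?X (compose ?I f g)"
      by (rule homeomorphic_map_eq[of _ _ "f \<circ> g"])
        (use fg in \<open>auto intro: homeomorphic_map_compose simp: compose_def\<close>)
    moreover have "strict_mono_on ?I (compose ?I f g)"
      using fg Bij_imp_funcset[of g ?I]
      by (intro strict_mono_onI) (auto simp: compose_def Pi_iff strict_mono_on_def)
    ultimately show "f \<otimes>\<^bsub>BijGroup ?I\<^esub> g \<in> ?H"
      using fg by (simp add: BijGroup_def compose_Bij)
  qed
  thus ?thesis unfolding homeo_plus_interval_def by (rule B.subgroup_imp_group)
qed

lemma group_homeo_plus_circle: "group homeo_plus_circle"
proof -
  let ?S = "carrier circle_group"
  let ?X = circle_topology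
  let ?L = "\<lambda>f F. homeomorphic_map euclidean euclidean F \<and> strict_mono F \<and>
          (\<forall>x::real. f (circle_proj x) = circle_proj (F x))"
  interpret B: group "BijGroup ?S" by (rule group_BijGroup)
  have pS: "circle_proj x \<in> ?S" for x by (auto simp: carrier_circle_group)
  have "subgroup {f \<in> Bij ?S. homeomorphic_map ?X ?X f \<and> (\<exists>F. ?L f F)} (BijGroup ?S)"
    (is "subgroup ?H _")
  proof (rule B.subgroupI)
    show "?H \<subseteq> carrier (BijGroup ?S)" by (auto simp: BijGroup_def)
    have "homeomorphic_map ?X ?X (\<lambda>x\<in>?S. x)"
      by (rule homeomorphic_map_eq[of _ _ id]) (auto simp: topspace_circle_topology)
    moreover have "?L (\<lambda>x\<in>?S. x) (\<lambda>x. x)" 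
      using homeomorphic_map_id[of euclidean euclidean] by (auto simp: pS id_def strict_mono_def)
    ultimately have "(\<lambda>x\<in>?S. x) \<in> ?H" using id_Bij[of ?S] by blast
    thus "?H \<noteq> {}" by blast
  next
    fix f assume f: "f \<in> ?H"
    let ?g = "\<lambda>x\<in>?S. inv_into ?S f x"
    from f have bij: "bij_betw f ?S ?S" by (simp add: Bij_def)
    from f obtain g where g: "homeomorphic_maps ?X ?X f g" by (auto simp: homeomorphic_map_maps)
    hence "homeomorphic_map ?X ?X g" by (metis homeomorphic_maps_map)
    moreover have "g x = ?g x" if "x \<in> ?S" for x
    proof -
      have "inj_on f ?S" "g x \<in> ?S" "f (g x) = x"
        using g that bij by (auto simp: homeomorphic_maps_def continuous_map_def Pi_iff bij_betw_def
            topspace_circle_topology)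
      hence "inv_into ?S f x = g x" by (rule inv_into_f_eq)
      thus ?thesis using that by simp
    qed
    ultimately have hg: "homeomorphic_map ?X ?X ?g"
      by (metis homeomorphic_map_eq topspace_circle_topology)
    from f obtain F where F: "?L f F" by auto
    then obtain G where G: "homeomorphic_maps euclidean euclidean F G"
      by (auto simp: homeomorphic_map_maps)
    hence FG: "F (G x) = x" for x by (auto simp: homeomorphic_maps_def)
    have "homeomorphic_map euclidean euclidean G" using G by (metis homeomorphic_maps_map)
    moreover have "strict_mono G"
      using F by (metis FG strict_mono_less strict_monoI)
    moreover have "?g (circle_proj x) = circle_proj (G x)" for x
    proof -
      have "f (circle_proj (G x)) = circle_proj x" using F FG by simp
      moreover have "inj_on f ?S" using bij by (simp add: bij_betw_def)
      ultimately show ?thesis using pS by (simp add: inv_into_f_eq)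
    qed
    ultimately have "\<exists>F. ?L ?g F" by blast
    with hg f show "inv\<^bsub>BijGroup ?S\<^esub> f \<in> ?H"
      by (simp add: inv_BijGroup restrict_inv_into_Bij)
  next
    fix f g assume fg: "f \<in> ?H" "g \<in> ?H"
    then obtain F G where FG: "?L f F" "?L g G" by blast
    have "homeomorphic_map ?X ?X (compose ?S f g)"
      by (rule homeomorphic_map_eq[of _ _ "f \<circ> g"])
        (use fg in \<open>auto intro: homeomorphic_map_compose simp: compose_def topspace_circle_topology\<close>)
    moreover have "?L (compose ?S f g) (F \<circ> G)"
      using FG homeomorphic_map_compose[of euclidean euclidean G euclidean F]
      by (auto simp: compose_def pS strict_mono_def)
    ultimately show "f \<otimes>\<^bsub>BijGroup ?S\<^esub> g \<in> ?H"
      using fg by (auto simp: BijGroup_def compose_Bij)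
  qed
  thus ?thesis unfolding homeo_plus_circle_def by (rule B.subgroup_imp_group)
qed

lemma group_wreath_product:
  assumes "group C" and "group T"
  shows "group (wreath_product C T)"
proof -
  interpret C: group C by fact
  interpret T: group T by fact
  let ?W = "wreath_product C T"
  show ?thesis
  proof (rule groupI)
    fix x y z assume "x \<in> carrier ?W" "y \<in> carrier ?W" "z \<in> carrier ?W"
    thus "x \<otimes>\<^bsub>?W\<^esub> y \<otimes>\<^bsub>?W\<^esub> z = x \<otimes>\<^bsub>?W\<^esub> (y \<otimes>\<^bsub>?W\<^esub> z)"
      by (auto simp: wreath_product_def semidirect_product_def PiE_iff C.m_assoc T.m_assoc
          T.inv_mult_group intro!: restrict_ext)
  next
    fix x assume "x \<in> carrier ?W"
    then obtain p s where x: "x = (p, s)" "p \<in> carrier T \<rightarrow>\<^sub>E carrier C" "s \<in> carrier T"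
      by (auto simp: wreath_product_def semidirect_product_def)
    let ?y = "(\<lambda>u\<in>carrier T. inv\<^bsub>C\<^esub> p (s \<otimes>\<^bsub>T\<^esub> u), inv\<^bsub>T\<^esub> s)"
    have "?y \<in> carrier ?W" "?y \<otimes>\<^bsub>?W\<^esub> x = \<one>\<^bsub>?W\<^esub>"
      using x by (auto simp: wreath_product_def semidirect_product_def PiE_iff intro!: restrict_ext)
    thus "\<exists>y\<in>carrier ?W. y \<otimes>\<^bsub>?W\<^esub> x = \<one>\<^bsub>?W\<^esub>" by blast
  qed (auto simp: wreath_product_def semidirect_product_def PiE_iff extensional_def fun_eq_iff)
qed

end

theory Submission
  imports Defs
begin

text \<open>
  This is Denjoy's construction on the universal cover: every point of the preimage \<open>A\<close> of \<open>K\<close>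
  in the line is blown up to a unit interval. Ordered lexicographically, the set of pairs \<open>(x, r)\<close>
  with \<open>r \<in> [0,1]\<close> if \<open>x \<in> A\<close> and \<open>r = 0\<close> otherwise is isomorphic to the line, by an isomorphism
  that is compatible with \<open>x \<mapsto> x + 1\<close>. A pair \<open>(\<phi>, s)\<close> of the wreath product sends \<open>(x, r)\<close> to
  \<open>(x + s, \<phi>\<^bsub>x+s\<^esub>(r))\<close>. This is an order automorphism, and increasing bijections of the line are
  homeomorphisms, so that it descends to the circle without any further check of continuity.
\<close>

section \<open>Arithmetic of the projection from the line to the circle\<close>

lemma circle_proj_eq_iff: "circle_proj x = circle_proj y \<longleftrightarrow> x - y \<in> \<int>"
proof
  assume "circle_proj x = circle_proj y"
  moreover have "x \<in> circle_proj x"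
    using Ints_0 by (force simp: circle_proj_def r_coset_def real_group_def)
  ultimately obtain n where "n \<in> \<int>" "x = n + y"
    by (auto simp: circle_proj_def r_coset_def real_group_def)
  thus "x - y \<in> \<int>" by simp
next
  assume *: "x - y \<in> \<int>"
  have "z - x \<in> \<int> \<longleftrightarrow> z - y \<in> \<int>" for z
    using Ints_add[OF _ *, of "z - x"] Ints_diff[OF _ *, of "z - y"] by auto
  moreover have "circle_proj v = {z. z - v \<in> \<int>}" for v
    by (force simp: circle_proj_def r_coset_def real_group_def)
  ultimately show "circle_proj x = circle_proj y" by simp
qed

lemma circle_proj_in_carrier [simp]: "circle_proj x \<in> carrier circle_group"
  by (simp add: carrier_circle_group)

lemma circle_proj_add:
  "circle_proj x \<otimes>\<^bsub>circle_group\<^esub> circle_proj y = circle_proj (x + y)"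
  using normal.rcos_sum[OF normal_Ints, of x y]
  by (simp add: circle_group_def FactGroup_def circle_proj_def) (simp add: real_group_def)

lemma circle_proj_minus: "inv\<^bsub>circle_group\<^esub> circle_proj x = circle_proj (- x)"
proof -
  interpret G: group circle_group by (rule group_circle_group)
  have "circle_proj 0 \<otimes>\<^bsub>circle_group\<^esub> circle_proj 0 = circle_proj 0"
    by (simp add: circle_proj_add)
  hence "circle_proj 0 = \<one>\<^bsub>circle_group\<^esub>"
    by (metis G.l_cancel_one circle_proj_in_carrier)
  thus ?thesis by (intro G.inv_equality) (simp_all add: circle_proj_add)
qed

section \<open>Descent of increasing equivariant maps of the line to the circle\<close>

definition circle_map :: "(real \<Rightarrow> real) \<Rightarrow> real set \<Rightarrow> real set"
  where "circle_map F = (\<lambda>c\<in>carrier circle_group. circle_proj (F (SOME x. circle_proj x = c)))"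

definition shift_equivariant :: "(real \<Rightarrow> real) \<Rightarrow> bool"
  where "shift_equivariant F \<longleftrightarrow> (\<forall>x. F (x + 1) = F x + 1)"

lemma shift_equivariant_of_int:
  assumes "shift_equivariant F"
  shows "F (x + of_int n) = F x + of_int n"
proof (induction n rule: int_induct[where k = 0])
  case (step1 i)
  have "F (x + of_int i + 1) = F (x + of_int i) + 1"
    using assms by (simp add: shift_equivariant_def)
  with step1 show ?case by (simp add: algebra_simps)
next
  case (step2 i)
  have "F (x + of_int (i - 1) + 1) = F (x + of_int (i - 1)) + 1"
    using assms by (simp only: shift_equivariant_def)
  with step2 show ?case by (simp add: algebra_simps)
qed simp

lemma shift_equivariant_comp:
  "shift_equivariant F \<Longrightarrow> shift_equivariant G \<Longrightarrow> shift_equivariant (F \<circ> G)"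
  by (simp add: shift_equivariant_def)

text \<open>Two representatives of a point differ by an integer, which an equivariant
  \<open>F\<close> carries through unchanged, so the choice made in \<open>circle_map\<close> does
  not matter.\<close>

lemma circle_map_circle_proj:
  assumes "shift_equivariant F"
  shows "circle_map F (circle_proj x) = circle_proj (F x)"
proof -
  let ?y = "SOME y. circle_proj y = circle_proj x"
  have "circle_proj ?y = circle_proj x" by (rule someI) simp
  then obtain n where n: "?y - x = of_int n" by (auto simp: circle_proj_eq_iff elim: Ints_cases)
  hence "?y = x + of_int n" by linarith
  hence "F ?y - F x = of_int n" by (simp add: shift_equivariant_of_int[OF assms])
  thus ?thesis by (simp add: circle_map_def circle_proj_eq_iff)
qed

lemma circle_map_eqI:
  assumes "f \<in> extensional (carrier circle_group)" and "shift_equivariant F"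
    and "\<And>x. f (circle_proj x) = circle_proj (F x)"
  shows "circle_map F = f"
proof (rule extensionalityI[of _ "carrier circle_group"])
  fix c assume "c \<in> carrier circle_group"
  thus "circle_map F c = f c"
    by (auto simp: carrier_circle_group circle_map_circle_proj[OF assms(2)] assms(3))
qed (use assms in \<open>auto simp: circle_map_def\<close>)

lemma circle_map_comp:
  assumes "shift_equivariant F" and "shift_equivariant G"
  shows "circle_map (F \<circ> G) = compose (carrier circle_group) (circle_map F) (circle_map G)"
  using assms
  by (intro circle_map_eqI)
    (auto simp: compose_def circle_map_circle_proj shift_equivariant_comp)

text \<open>A monotone function can be discontinuous only by jumping, and a jump would leave a gap
  in the range.\<close>

lemma continuous_strict_mono_surj:
  fixes F :: "real \<Rightarrow> real"
  assumes "strict_mono F" and "surj F"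
  shows "continuous_on UNIV F"
  using assms by (intro continuous_onI_mono) (auto simp: strict_mono_less_eq)

lemma inv_strict_mono_surj:
  fixes F :: "real \<Rightarrow> real"
  assumes "strict_mono F" and "surj F"
  shows "strict_mono (inv_into UNIV F)" "surj (inv_into UNIV F)"
  using assms
  by (auto simp: surj_f_inv_f strict_mono_imp_inj_on intro!: strict_monoI inj_imp_surj_inv)
    (metis strict_mono_less surj_f_inv_f)

text \<open>Universal property of the quotient topology: continuity only has to be checked after
  composing with the projection, where the map becomes \<open>circle_proj \<circ> F\<close>.\<close>

lemma continuous_circle_map:
  assumes "strict_mono F" and "surj F" and "shift_equivariant F"
  shows "continuous_map circle_topology circle_topology (circle_map F)"
proof -
  have "continuous_map euclidean circle_topology (circle_proj \<circ> F)"
    using continuous_strict_mono_surj[OF assms(1,2)] quotient_map_circle_proj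
    by (intro continuous_map_compose[of _ euclidean]) (auto simp: quotient_imp_continuous_map)
  moreover have "circle_map F \<circ> circle_proj = circle_proj \<circ> F"
    by (auto simp: circle_map_circle_proj[OF assms(3)])
  ultimately show ?thesis
    using continuous_compose_quotient_map_eq[OF quotient_map_circle_proj] by metis
qed

text \<open>The inverse of \<open>F\<close> satisfies the same three hypotheses, so it descends to a
  continuous inverse; \<open>F\<close> itself is the increasing lift that
  \<open>homeo_plus_circle\<close> asks for.\<close>

lemma circle_map_homeo_plus:
  assumes F: "strict_mono F" "surj F" and shift: "shift_equivariant F"
  shows "circle_map F \<in> carrier homeo_plus_circle"
proof -
  let ?G = "inv_into UNIV F"
  have inj: "inj F" using F(1) by (rule strict_mono_imp_inj_on)
  note G = inv_strict_mono_surj[OF F]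
  have shiftG: "shift_equivariant ?G"
    unfolding shift_equivariant_def
    by (intro allI inv_f_eq[OF inj])
      (use shift in \<open>simp add: shift_equivariant_def surj_f_inv_f[OF F(2)]\<close>)
  have "homeomorphic_maps circle_topology circle_topology (circle_map F) (circle_map ?G)"
    unfolding homeomorphic_maps_def topspace_circle_topology carrier_circle_group
    using continuous_circle_map[OF F shift] continuous_circle_map[OF G shiftG]
    by (auto simp: circle_map_circle_proj[OF shift] circle_map_circle_proj[OF shiftG]
        surj_f_inv_f[OF F(2)] inv_f_f[OF inj])
  hence homeo: "homeomorphic_map circle_topology circle_topology (circle_map F)"
    by (rule homeomorphic_maps_map[THEN iffD1, THEN conjunct1])
  have "homeomorphic_maps euclidean euclidean F ?G"
    using continuous_strict_mono_surj[OF F] continuous_strict_mono_surj[OF G]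
    by (auto simp: homeomorphic_maps_def surj_f_inv_f[OF F(2)] inv_f_f[OF inj])
  hence "homeomorphic_map euclidean euclidean F"
    by (rule homeomorphic_maps_map[THEN iffD1, THEN conjunct1])
  moreover have "circle_map F \<in> Bij (carrier circle_group)"
    using homeomorphic_imp_injective_map[OF homeo] homeomorphic_imp_surjective_map[OF homeo]
    by (auto simp: Bij_def bij_betw_def topspace_circle_topology circle_map_def)
  ultimately show ?thesis
    using homeo F(1) by (auto simp: homeo_plus_circle_def circle_map_circle_proj[OF shift])
qed

section \<open>Series with geometric weights\<close>

definition half_series :: "(nat \<Rightarrow> real) \<Rightarrow> real"
  where "half_series f = suminf (\<lambda>n. (1/2)^Suc n * f n)"

lemma summable_half_series:
  fixes f :: "nat \<Rightarrow> real"
  assumes "\<And>n. \<bar>f n\<bar> \<le> d"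
  shows "summable (\<lambda>n. (1/2)^Suc n * f n)"
proof (rule summable_comparison_test')
  show "summable (\<lambda>n. (1/2)^Suc n * d)"
    using power_half_series by (intro summable_mult2) (rule sums_summable)
  show "norm ((1/2)^Suc n * f n) \<le> (1/2)^Suc n * d" for n
    using assms[of n] by (simp add: abs_mult)
qed

text \<open>With the exponent starting at \<open>Suc 0\<close> the weights sum to 1 and not to 2,
  hence a unit shift of all terms comes out as a unit shift.\<close>

lemma half_series_add_one:
  assumes "\<And>n. \<bar>f n\<bar> \<le> d"
  shows "half_series (\<lambda>n. f n + 1) = half_series f + 1"
proof -
  have "(\<lambda>n. (1/2)^Suc n * f n + (1/2)^Suc n) sums (half_series f + 1)"
    unfolding half_series_def
    by (intro sums_add summable_sums summable_half_series[of f d] assms power_half_series)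
  thus ?thesis unfolding half_series_def by (simp add: sums_iff distrib_left)
qed

lemma half_series_mono:
  assumes "\<And>n. \<bar>f n\<bar> \<le> d" "\<And>n. \<bar>g n\<bar> \<le> d'" "\<And>n. f n \<le> g n"
  shows "half_series f \<le> half_series g"
  unfolding half_series_def
  by (intro suminf_le summable_half_series[of f d] summable_half_series[of g d'] mult_left_mono
      assms) simp

text \<open>All weights are positive, so that a single strict inequality survives summation.\<close>

lemma half_series_strict_mono:
  assumes "\<And>n. \<bar>f n\<bar> \<le> d" "\<And>n. \<bar>g n\<bar> \<le> d'" "\<And>n. f n \<le> g n" "f m < g m"
  shows "half_series f < half_series g"
proof -
  note sum = summable_half_series[of f d, OF assms(1)] summable_half_series[of g d', OF assms(2)]
  have "0 < suminf (\<lambda>n. (1/2)^Suc n * g n - (1/2)^Suc n * f n)"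
  proof (rule suminf_pos2[of _ m])
    show "0 \<le> (1/2)^Suc n * g n - (1/2)^Suc n * f n" for n
      using assms(3)[of n] by simp
  qed (use assms(4) in \<open>auto intro!: summable_diff sum simp del: power_Suc\<close>)
  thus ?thesis unfolding half_series_def suminf_diff[OF sum(2,1), symmetric] by simp
qed

text \<open>Dominated convergence for series (Tannery's theorem): the bound \<open>d\<close>,
  uniform in \<open>n\<close>, yields a geometric majorant.\<close>

lemma tendsto_half_series:
  assumes "\<And>n. ((\<lambda>y. f y n) \<longlongrightarrow> g n) F" and "\<forall>\<^sub>F y in F. \<forall>n. \<bar>f y n\<bar> \<le> d" and "F \<noteq> bot"
  shows "((\<lambda>y. half_series (f y)) \<longlongrightarrow> half_series g) F"
proof -
  have "\<forall>\<^sub>F y in F. \<forall>n. norm ((1/2)^Suc n * f y n) \<le> (1/2)^Suc n * d"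
    using assms(2) by eventually_elim (simp add: abs_mult)
  hence bound: "\<forall>\<^sub>F (n, y) in sequentially \<times>\<^sub>F F. norm ((1/2)^Suc n * f y n) \<le> (1/2)^Suc n * d"
    unfolding eventually_prod_filter by (intro exI[of _ "\<lambda>_. True"] exI conjI) auto
  have lim: "((\<lambda>y. (1/2)^Suc n * f y n) \<longlongrightarrow> (1/2)^Suc n * g n) F" for n
    by (intro tendsto_mult tendsto_const assms(1))
  have "summable (\<lambda>n. (1/2)^Suc n * d)" by (rule summable_half_series) (rule order_refl)
  from tannerys_theorem[OF lim bound this assms(3)] show ?thesis
    unfolding half_series_def by blast
qed

definition blowup :: "real set \<Rightarrow> (real \<times> real) set"
  where "blowup A = (SIGMA x:UNIV. if x \<in> A then {0..1} else {0})"

text \<open>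
  The functions \<open>lower\<close> and \<open>upper\<close> below are the left- and right-continuous versions of one
  strictly increasing function that jumps exactly at the points of \<open>k\<close> modulo 1. The sequence may
  repeat points, which only enlarges the jump there and covers finite groups \<open>K\<close>. The summand
  \<open>k n\<close> makes the terms bounded, uniformly in \<open>n\<close>.
\<close>

locale circle_weights =
  fixes k :: "nat \<Rightarrow> real"
begin

definition points :: "real set"
  where "points = {x. \<exists>n. x - k n \<in> \<int>}"

definition lower :: "real \<Rightarrow> real"
  where "lower x = (x + half_series (\<lambda>n. of_int \<lceil>x - k n\<rceil> + k n)) / 2"

definition upper :: "real \<Rightarrow> real"
  where "upper x = (x + half_series (\<lambda>n. of_int \<lfloor>x - k n\<rfloor> + 1 + k n)) / 2"

text \<open>Linear interpolation across the jump at \<open>x\<close>. On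
  \<open>blowup points\<close> this is the order isomorphism onto the line.\<close>

definition param :: "real \<times> real \<Rightarrow> real"
  where "param = (\<lambda>(x, r). lower x + r * (upper x - lower x))"

lemma term_bounds:
  "\<bar>of_int \<lceil>x - k n\<rceil> + k n\<bar> \<le> \<bar>x\<bar> + 1" "\<bar>of_int \<lfloor>x - k n\<rfloor> + 1 + k n\<bar> \<le> \<bar>x\<bar> + 1"
  by linarith+

text \<open>The linear summand and the series each grow by 1 under a unit translation; the halving
  in \<open>lower\<close> brings the total back to 1.\<close>

lemma shift_equivariant_lower: "shift_equivariant lower"
  unfolding shift_equivariant_def
proof
  fix x
  have "of_int \<lceil>x + 1 - k n\<rceil> + k n = (of_int \<lceil>x - k n\<rceil> + k n) + 1" for n
    using ceiling_add_one[of "x - k n"] by (simp add: algebra_simps)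
  thus "lower (x + 1) = lower x + 1"
    unfolding lower_def by (simp only: half_series_add_one[OF term_bounds(1)]) (simp add: field_simps)
qed

lemma shift_equivariant_upper: "shift_equivariant upper"
  unfolding shift_equivariant_def
proof
  fix x
  have "of_int \<lfloor>x + 1 - k n\<rfloor> + 1 + k n = (of_int \<lfloor>x - k n\<rfloor> + 1 + k n) + 1" for n
    using floor_add_int[of "x - k n" 1] by (simp add: algebra_simps)
  thus "upper (x + 1) = upper x + 1"
    unfolding upper_def by (simp only: half_series_add_one[OF term_bounds(2)]) (simp add: field_simps)
qed

text \<open>The series contributes a weak inequality only, since
  \<open>\<lfloor>x - k n\<rfloor> + 1\<close> and \<open>\<lceil>y - k n\<rceil>\<close> may agree
  for all \<open>n\<close>; the linear summand makes it strict.\<close>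

lemma upper_less_lower:
  assumes "x < y"
  shows "upper x < lower y"
proof -
  have "half_series (\<lambda>n. of_int \<lfloor>x - k n\<rfloor> + 1 + k n) \<le> half_series (\<lambda>n. of_int \<lceil>y - k n\<rceil> + k n)"
  proof (rule half_series_mono[OF term_bounds(2) term_bounds(1)])
    fix n
    have "\<lfloor>x - k n\<rfloor> + 1 \<le> \<lceil>y - k n\<rceil>" using assms by linarith
    hence "real_of_int (\<lfloor>x - k n\<rfloor> + 1) \<le> real_of_int \<lceil>y - k n\<rceil>" by (rule of_int_le_iff[THEN iffD2])
    thus "of_int \<lfloor>x - k n\<rfloor> + 1 + k n \<le> of_int \<lceil>y - k n\<rceil> + k n" by simp
  qed
  with assms show ?thesis by (simp add: lower_def upper_def)
qed

lemma lower_term_le: "of_int \<lceil>x - k n\<rceil> + k n \<le> of_int \<lfloor>x - k n\<rfloor> + 1 + k n"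
proof -
  have "\<lceil>x - k n\<rceil> \<le> \<lfloor>x - k n\<rfloor> + 1" by linarith
  hence "real_of_int \<lceil>x - k n\<rceil> \<le> real_of_int (\<lfloor>x - k n\<rfloor> + 1)" by (rule of_int_le_iff[THEN iffD2])
  thus ?thesis by simp
qed

lemma lower_le_upper: "lower x \<le> upper x"
  using half_series_mono[OF term_bounds(1) term_bounds(2) lower_term_le, of x]
  by (simp add: lower_def upper_def)

text \<open>For non-integral \<open>t\<close>, \<open>\<lceil>t\<rceil>\<close> equals
  \<open>\<lfloor>t\<rfloor> + 1\<close>, while for integral \<open>t\<close> it is smaller by 1.
  Only indices with \<open>x - k n\<close> integral therefore contribute to the jump.\<close>

lemma lower_less_upper_iff: "lower x < upper x \<longleftrightarrow> x \<in> points"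
proof
  assume less: "lower x < upper x"
  show "x \<in> points"
  proof (rule ccontr)
    assume "x \<notin> points"
    hence "x - k n \<noteq> of_int \<lfloor>x - k n\<rfloor>" for n by (metis Ints_of_int points_def mem_Collect_eq)
    hence "\<lceil>x - k n\<rceil> = \<lfloor>x - k n\<rfloor> + 1" for n by (metis ceiling_altdef)
    hence "lower x = upper x" by (simp add: lower_def upper_def)
    with less show False by simp
  qed
next
  assume "x \<in> points"
  then obtain m where "x - k m \<in> \<int>" by (auto simp: points_def)
  hence "of_int \<lceil>x - k m\<rceil> + k m < of_int \<lfloor>x - k m\<rfloor> + 1 + k m"
    by (metis Ints_cases ceiling_of_int floor_of_int add_less_cancel_right less_add_one)
  hence "half_series (\<lambda>n. of_int \<lceil>x - k n\<rceil> + k n)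
      < half_series (\<lambda>n. of_int \<lfloor>x - k n\<rfloor> + 1 + k n)"
    by (rule half_series_strict_mono[OF term_bounds(1) term_bounds(2) lower_term_le])
  thus "lower x < upper x" by (simp add: lower_def upper_def)
qed

text \<open>The bounds in \<open>term_bounds\<close> vary with the point; near \<open>x\<close> this
  replaces them by the one constant that dominated convergence requires.\<close>

lemma eventually_abs_le: "\<forall>\<^sub>F y in at x within S. \<bar>y\<bar> + 1 \<le> \<bar>x\<bar> + (2::real)"
  unfolding eventually_at by (intro exI[of _ 1]) (auto simp: dist_real_def)

text \<open>The ceiling is left-continuous, each term being constant just to the left of
  \<open>x\<close>, and \<open>tendsto_half_series\<close> passes to the sum.\<close>

lemma tendsto_lower: "(lower \<longlongrightarrow> lower x) (at_left x)"
  unfolding lower_def[abs_def]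
proof (intro tendsto_intros tendsto_half_series)
  show "\<forall>\<^sub>F y in at_left x. \<forall>n. \<bar>of_int \<lceil>y - k n\<rceil> + k n\<bar> \<le> \<bar>x\<bar> + 2"
    using eventually_abs_le by eventually_elim (use term_bounds(1) order_trans in blast)
  fix n
  show "((\<lambda>y. real_of_int \<lceil>y - k n\<rceil>) \<longlongrightarrow> of_int \<lceil>x - k n\<rceil>) (at_left x)"
  proof (rule tendsto_eventually, rule eventually_at_leftI)
    \<comment> \<open>This is the last point before \<open>x\<close> at which \<open>y - k n\<close>
      is an integer; the ceiling is constant from there, exclusively, up to
      \<open>x\<close>.\<close>
    show "of_int \<lceil>x - k n\<rceil> - 1 + k n < x" by linarith
    fix y assume y: "y \<in> {of_int \<lceil>x - k n\<rceil> - 1 + k n<..<x}"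
    hence "\<lceil>y - k n\<rceil> = \<lceil>x - k n\<rceil>" unfolding greaterThanLessThan_iff by linarith
    thus "real_of_int \<lceil>y - k n\<rceil> = of_int \<lceil>x - k n\<rceil>" by simp
  qed
qed simp_all

lemma tendsto_upper: "(upper \<longlongrightarrow> upper x) (at_right x)"
  unfolding upper_def[abs_def]
proof (intro tendsto_intros tendsto_half_series)
  show "\<forall>\<^sub>F y in at_right x. \<forall>n. \<bar>of_int \<lfloor>y - k n\<rfloor> + 1 + k n\<bar> \<le> \<bar>x\<bar> + 2"
    using eventually_abs_le by eventually_elim (use term_bounds(2) order_trans in blast)
  fix n
  show "((\<lambda>y. real_of_int \<lfloor>y - k n\<rfloor>) \<longlongrightarrow> of_int \<lfloor>x - k n\<rfloor>) (at_right x)"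
  proof (rule tendsto_eventually, rule eventually_at_rightI)
    show "x < of_int \<lfloor>x - k n\<rfloor> + 1 + k n" by linarith
    fix y assume y: "y \<in> {x<..<of_int \<lfloor>x - k n\<rfloor> + 1 + k n}"
    hence "\<lfloor>y - k n\<rfloor> = \<lfloor>x - k n\<rfloor>" unfolding greaterThanLessThan_iff by linarith
    thus "real_of_int \<lfloor>y - k n\<rfloor> = of_int \<lfloor>x - k n\<rfloor>" by simp
  qed
qed simp_all

lemma param_bounds:
  assumes "(x, r) \<in> blowup points"
  shows "lower x \<le> param (x, r)" "param (x, r) \<le> upper x"
proof -
  have r: "0 \<le> r" "r \<le> 1" using assms by (auto simp: blowup_def split: if_splits)
  show "lower x \<le> param (x, r)" using r lower_le_upper[of x] by (simp add: param_def)
  have "r * (upper x - lower x) \<le> upper x - lower x"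
    using r lower_le_upper[of x] by (intro mult_left_le_one_le) auto
  thus "param (x, r) \<le> upper x" by (simp add: param_def)
qed

text \<open>Distinct first coordinates have disjoint, ordered ranges by
  \<open>upper_less_lower\<close>. Over a single \<open>x\<close>, the fibre has room for
  \<open>r < s\<close> only if \<open>x\<close> lies in \<open>points\<close>, and there the
  interpolation has positive slope.\<close>

lemma param_strict_mono:
  assumes "(x, r) \<in> blowup points" "(y, s) \<in> blowup points"
    and "x < y \<or> x = y \<and> r < s"
  shows "param (x, r) < param (y, s)"
  using assms(3)
proof
  assume "x < y"
  thus ?thesis
    using param_bounds[OF assms(1)] param_bounds[OF assms(2)] upper_less_lower[of x y] by linarith
next
  assume *: "x = y \<and> r < s"
  hence "x \<in> points" using assms(1,2) by (auto simp: blowup_def split: if_splits)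
  thus ?thesis using * lower_less_upper_iff[of x] by (simp add: param_def)
qed

text \<open>The required point is the supremum of all \<open>x\<close> with
  \<open>lower x \<le> y\<close>: left continuity of \<open>lower\<close> and right continuity of
  \<open>upper\<close> carry the two inequalities to it.\<close>

lemma between_lower_upper: "\<exists>x. lower x \<le> y \<and> y \<le> upper x"
proof -
  let ?S = "{x. lower x \<le> y}"
  \<comment> \<open>By equivariance \<open>lower\<close> is known at integers; \<open>- n\<close>
    shows that the set is nonempty, and \<open>n\<close> bounds it above.\<close>
  define n where "n = \<lceil>\<bar>y - lower 0\<bar>\<rceil>"
  have n: "\<bar>y - lower 0\<bar> \<le> of_int n" unfolding n_def by (rule le_of_int_ceiling)
  have low: "lower (of_int m) = lower 0 + of_int m" for m
    using shift_equivariant_of_int[OF shift_equivariant_lower, of 0 m] by simp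
  have ne: "?S \<noteq> {}" using low[of "- n"] n by (intro ex_in_conv[THEN iffD1] exI[of _ "of_int (- n)"]) auto
  have "x \<le> of_int n" if "x \<in> ?S" for x
  proof (rule ccontr)
    assume "\<not> x \<le> of_int n"
    hence "lower (of_int n) < lower x" 
      using upper_less_lower[of "of_int n" x] lower_le_upper[of "of_int n"] by linarith
    with that low[of n] n show False by auto
  qed
  hence bdd: "bdd_above ?S" by (rule bdd_aboveI)
  let ?x = "Sup ?S"
  have "lower x \<le> y" if "x < ?x" for x
  proof -
    obtain z where "z \<in> ?S" "x < z" using less_cSup_iff[OF ne bdd] \<open>x < ?x\<close> by blast
    thus ?thesis using upper_less_lower[of x z] lower_le_upper[of x] by auto
  qed
  hence "lower ?x \<le> y"
    by (intro tendsto_upperbound[OF tendsto_lower])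
      (auto simp: eventually_at_left[of "?x - 1"] intro!: exI[of _ "?x - 1"])
  moreover have "y \<le> upper x" if "?x < x" for x
  proof -
    have "x \<notin> ?S" using cSup_upper[OF _ bdd] that by (meson not_le)
    thus ?thesis using lower_le_upper[of x] by auto
  qed
  hence "y \<le> upper ?x"
    by (intro tendsto_lowerbound[OF tendsto_upper])
      (auto simp: eventually_at_right[of _ "?x + 1"] intro!: exI[of _ "?x + 1"])
  ultimately show ?thesis by blast
qed

lemma param_surj: "\<exists>p\<in>blowup points. param p = y"
proof -
  obtain x where x: "lower x \<le> y" "y \<le> upper x" using between_lower_upper by blast
  show ?thesis
  proof (cases "x \<in> points")
    case True
    hence "lower x < upper x" by (simp add: lower_less_upper_iff)
    with x True show ?thesis
      by (intro bexI[of _ "(x, (y - lower x) / (upper x - lower x))"])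
        (auto simp: param_def blowup_def divide_simps)
  next
    case False
    hence "y = lower x" using lower_less_upper_iff[of x] x by auto
    with False show ?thesis by (intro bexI[of _ "(x, 0)"]) (auto simp: param_def blowup_def)
  qed
qed

lemma param_inj:
  assumes "p \<in> blowup points" "q \<in> blowup points" "param p = param q"
  shows "p = q"
  using assms param_strict_mono[of "fst p" "snd p" "fst q" "snd q"]
    param_strict_mono[of "fst q" "snd q" "fst p" "snd p"]
  by (metis less_irrefl linorder_neqE prod.collapse)

lemma param_add_of_int: "param (x + of_int n, r) = param (x, r) + of_int n"
  by (simp add: param_def shift_equivariant_of_int shift_equivariant_lower shift_equivariant_upper)

end

section \<open>The action of the wreath product on the line\<close>

locale wreath_action = circle_weights +
  fixes K :: "real set set"
  assumes subgroup_K: "subgroup K circle_group"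
    and points_iff: "x \<in> points \<longleftrightarrow> circle_proj x \<in> K"
begin

lemma points_add: "x \<in> points \<Longrightarrow> y \<in> points \<Longrightarrow> x + y \<in> points"
  using subgroup.m_closed[OF subgroup_K] by (simp add: points_iff flip: circle_proj_add)

lemma points_minus: "x \<in> points \<Longrightarrow> - x \<in> points"
  using subgroup.m_inv_closed[OF subgroup_K] by (simp add: points_iff flip: circle_proj_minus)

text \<open>As \<open>points\<close> is a group, translation by \<open>s\<close> takes interval
  fibres to interval fibres and single points to single points.\<close>

lemma points_add_iff: "s \<in> points \<Longrightarrow> x + s \<in> points \<longleftrightarrow> x \<in> points"
  using points_add[of x s] points_add[of "x + s" "- s"] points_minus[of s] by auto

text \<open>Here \<open>s\<close> is a real representative of an element of \<open>K\<close>. The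
  interval map is indexed by the target \<open>x + s\<close>, which matches the left regular action
  in \<open>wreath_product\<close>.\<close>

definition act :: "(real set \<Rightarrow> real \<Rightarrow> real) \<Rightarrow> real \<Rightarrow> real \<times> real \<Rightarrow> real \<times> real"
  where "act \<phi> s = (\<lambda>(x, r). (x + s, if x + s \<in> points then \<phi> (circle_proj (x + s)) r else r))"

definition lift :: "(real set \<Rightarrow> real \<Rightarrow> real) \<Rightarrow> real \<Rightarrow> real \<Rightarrow> real"
  where "lift \<phi> s y = param (act \<phi> s (inv_into (blowup points) param y))"

lemma lift_param: "p \<in> blowup points \<Longrightarrow> lift \<phi> s (param p) = param (act \<phi> s p)"
  using param_inj by (simp add: lift_def inv_into_f_f inj_on_def)

lemma lift_eqI:
  assumes "\<And>p. p \<in> blowup points \<Longrightarrow> F (param p) = param (act \<phi> s p)"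
  shows "F = lift \<phi> s"
proof
  fix y
  obtain p where "p \<in> blowup points" "param p = y" using param_surj by blast
  thus "F y = lift \<phi> s y" using assms lift_param by metis
qed

context
  fixes \<phi> s
  assumes \<phi>: "\<phi> \<in> K \<rightarrow> carrier homeo_plus_interval" and s: "s \<in> points"
begin

lemma interval_bij: "x \<in> points \<Longrightarrow> bij_betw (\<phi> (circle_proj x)) {0..1} {0..1}"
  using \<phi> by (auto simp: points_iff homeo_plus_interval_def Bij_def)

lemma interval_mono: "x \<in> points \<Longrightarrow> strict_mono_on {0..1} (\<phi> (circle_proj x))"
  using \<phi> by (auto simp: points_iff homeo_plus_interval_def)

lemma act_in_blowup: "p \<in> blowup points \<Longrightarrow> act \<phi> s p \<in> blowup points"
  using bij_betw_apply[OF interval_bij]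
  by (auto simp: act_def blowup_def points_add_iff[OF s] split: if_splits)

lemma act_surj:
  assumes "q \<in> blowup points"
  shows "\<exists>p\<in>blowup points. act \<phi> s p = q"
proof -
  obtain x r where q: "q = (x, r)" by (cases q)
  have mem: "x - s \<in> points \<longleftrightarrow> x \<in> points" using points_add_iff[OF s, of "x - s"] by simp
  show ?thesis
  proof (cases "x \<in> points")
    case True
    hence "r \<in> {0..1}" using assms by (simp add: q blowup_def)
    then obtain r' where "r' \<in> {0..1}" "\<phi> (circle_proj x) r' = r"
      using interval_bij[OF True] by (metis bij_betw_imp_surj_on imageE)
    thus ?thesis using True mem by (intro bexI[of _ "(x - s, r')"]) (auto simp: act_def q blowup_def)
  next
    case False
    thus ?thesis using assms mem
      by (intro bexI[of _ "(x - s, r)"]) (auto simp: act_def q blowup_def)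
  qed
qed

lemma act_strict_mono:
  assumes "p \<in> blowup points" "q \<in> blowup points" and "param p < param q"
  shows "param (act \<phi> s p) < param (act \<phi> s q)"
proof -
  obtain x r y t where pq: "p = (x, r)" "q = (y, t)" by (cases p, cases q)
  \<comment> \<open>Totality of the lexicographic order turns the inequality of parameters back into
    one of pairs.\<close>
  have "\<not> (y < x \<or> y = x \<and> t < r)" "p \<noteq> q"
    using param_strict_mono[of y t x r] assms by (auto simp: pq)
  hence less: "x < y \<or> x = y \<and> r < t" by (auto simp: pq)
  have "fst (act \<phi> s p) < fst (act \<phi> s q)
      \<or> fst (act \<phi> s p) = fst (act \<phi> s q) \<and> snd (act \<phi> s p) < snd (act \<phi> s q)"
    using less
  proof
    assume xy: "x = y \<and> r < t"
    hence "x \<in> points" "r \<in> {0..1}" "t \<in> {0..1}"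
      using assms by (auto simp: pq blowup_def split: if_splits)
    thus ?thesis
      using xy strict_mono_onD[OF interval_mono[of "x + s"], of r t] points_add_iff[OF s, of x]
      by (auto simp: act_def pq)
  qed (auto simp: act_def pq)
  thus ?thesis
    using param_strict_mono[of "fst (act \<phi> s p)" "snd (act \<phi> s p)"
        "fst (act \<phi> s q)" "snd (act \<phi> s q)"]
      act_in_blowup[OF assms(1)] act_in_blowup[OF assms(2)]
    by simp
qed

lemma strict_mono_lift: "strict_mono (lift \<phi> s)"
proof (rule strict_monoI)
  fix x y :: real assume "x < y"
  moreover obtain p q where "p \<in> blowup points" "param p = x" "q \<in> blowup points" "param q = y"
    using param_surj by metis
  ultimately show "lift \<phi> s x < lift \<phi> s y" using act_strict_mono lift_param by metis
qed

lemma surj_lift: "surj (lift \<phi> s)"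
  unfolding surj_def
proof
  fix y
  obtain q where q: "q \<in> blowup points" "param q = y" using param_surj by blast
  then obtain p where "p \<in> blowup points" "act \<phi> s p = q" using act_surj by blast
  with q show "\<exists>x. y = lift \<phi> s x" using lift_param by metis
qed

end

lemma act_add_of_int:
  "act \<phi> s (x + of_int n, r) = (fst (act \<phi> s (x, r)) + of_int n, snd (act \<phi> s (x, r)))"
proof -
  have "circle_proj (x + of_int n + s) = circle_proj (x + s)" by (simp add: circle_proj_eq_iff)
  thus ?thesis by (simp add: act_def points_iff)
qed

text \<open>Changing the representative of an element of \<open>K\<close> moves images by an integer
  only, which disappears on the circle.\<close>

lemma act_representative:
  "act \<phi> (s + of_int n) p = (fst (act \<phi> s p) + of_int n, snd (act \<phi> s p))"
proof -
  have "circle_proj (x + (s + of_int n)) = circle_proj (x + s)" for x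
    by (simp add: circle_proj_eq_iff)
  thus ?thesis by (simp add: act_def points_iff split: prod.splits)
qed

lemma blowup_add_of_int: "(x + of_int n, r) \<in> blowup points \<longleftrightarrow> (x, r) \<in> blowup points"
proof -
  have "circle_proj (x + of_int n) = circle_proj x" by (simp add: circle_proj_eq_iff)
  thus ?thesis by (simp add: blowup_def points_iff)
qed

lemma param_fst_add_of_int: "param (fst p + of_int n, snd p) = param p + of_int n"
  using param_add_of_int[of "fst p" n "snd p"] by simp

lemma shift_equivariant_lift: "shift_equivariant (lift \<phi> s)"
  unfolding shift_equivariant_def
proof
  fix y
  obtain x r where p: "(x, r) \<in> blowup points" "param (x, r) = y"
    using param_surj by (metis surj_pair)
  hence "(x + of_int 1, r) \<in> blowup points" "param (x + of_int 1, r) = y + 1"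
    using blowup_add_of_int[of x 1] param_add_of_int[of x 1] by auto
  hence "lift \<phi> s (y + 1) = param (act \<phi> s (x + of_int 1, r))" using lift_param by metis
  also have "\<dots> = lift \<phi> s y + 1"
    unfolding act_add_of_int param_fst_add_of_int using lift_param[OF p(1)] p(2) by simp
  finally show "lift \<phi> s (y + 1) = lift \<phi> s y + 1" .
qed

lemma circle_map_lift_cong:
  assumes "circle_proj s = circle_proj t"
  shows "circle_map (lift \<phi> s) = circle_map (lift \<phi> t)"
proof (rule circle_map_eqI[OF _ shift_equivariant_lift])
  obtain n where "s - t = of_int n" using assms by (auto simp: circle_proj_eq_iff elim: Ints_cases)
  hence "s = t + of_int n" by linarith
  hence "lift \<phi> s y = lift \<phi> t y + of_int n" for y
    by (simp add: lift_def act_representative param_fst_add_of_int)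
  thus "circle_map (lift \<phi> t) (circle_proj y) = circle_proj (lift \<phi> s y)" for y
    by (simp add: circle_map_circle_proj[OF shift_equivariant_lift] circle_proj_eq_iff)
qed (simp add: circle_map_def)

lemma circle_map_lift_homeo_plus:
  assumes "\<phi> \<in> K \<rightarrow> carrier homeo_plus_interval" and "s \<in> points"
  shows "circle_map (lift \<phi> s) \<in> carrier homeo_plus_circle"
  using assms by (intro circle_map_homeo_plus strict_mono_lift surj_lift shift_equivariant_lift)

text \<open>A pair ending over \<open>x\<close> was over \<open>x - s\<close> after the first map,
  whence the shifted index of \<open>\<psi>\<close>: this is the twist in the wreath
  product.\<close>

lemma lift_comp:
  assumes "\<psi> \<in> K \<rightarrow> carrier homeo_plus_interval" and "s \<in> points" "t \<in> points"
    and "\<And>x. x \<in> points \<Longrightarrow>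
      \<rho> (circle_proj x) = compose {0..1} (\<phi> (circle_proj x)) (\<psi> (circle_proj (x - s)))"
  shows "lift \<phi> s \<circ> lift \<psi> t = lift \<rho> (s + t)"
proof (rule lift_eqI)
  fix p assume p: "p \<in> blowup points"
  obtain x r where xr: "p = (x, r)" by (cases p)
  \<comment> \<open>On the interval the extensional \<open>compose\<close> agrees with ordinary
    composition.\<close>
  have "r \<in> {0..1}" using p by (auto simp: xr blowup_def split: if_splits)
  hence "act \<phi> s (act \<psi> t p) = act \<rho> (s + t) p"
    using points_add_iff[OF assms(2), of "x + t"] assms(4)[of "x + (s + t)"]
    by (auto simp: act_def xr compose_def algebra_simps)
  thus "(lift \<phi> s \<circ> lift \<psi> t) (param p) = param (act \<rho> (s + t) p)"
    using lift_param p act_in_blowup[OF assms(1,3) p] by simp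
qed

text \<open>Equality on the circle makes the two actions agree up to an integer in the first
  coordinate. That coordinate then determines the rotation, the second one the interval
  maps.\<close>

lemma circle_map_lift_inj:
  assumes "\<phi> \<in> K \<rightarrow> carrier homeo_plus_interval" "\<psi> \<in> K \<rightarrow> carrier homeo_plus_interval"
    and "s \<in> points" "t \<in> points"
    and "circle_map (lift \<phi> s) = circle_map (lift \<psi> t)"
  shows "circle_proj s = circle_proj t"
    and "\<lbrakk>u \<in> K; r \<in> {0..1}\<rbrakk> \<Longrightarrow> \<phi> u r = \<psi> u r"
proof -
  \<comment> \<open>The integer may depend on \<open>p\<close>, so its constancy need not be
    proved.\<close>
  have *: "\<exists>n. act \<phi> s p = (fst (act \<psi> t p) + of_int n, snd (act \<psi> t p))"
    if p: "p \<in> blowup points" for p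
  proof -
    have "circle_proj (lift \<phi> s (param p)) = circle_proj (lift \<psi> t (param p))"
      using assms(5) by (metis circle_map_circle_proj shift_equivariant_lift)
    then obtain n where n: "param (act \<phi> s p) - param (act \<psi> t p) = of_int n"
      by (auto simp: circle_proj_eq_iff lift_param[OF p] elim: Ints_cases)
    show ?thesis
    proof (intro exI[of _ n] param_inj)
      show "act \<phi> s p \<in> blowup points" by (rule act_in_blowup[OF assms(1,3) p])
      show "(fst (act \<psi> t p) + of_int n, snd (act \<psi> t p)) \<in> blowup points"
        using act_in_blowup[OF assms(2,4) p] by (simp add: blowup_add_of_int)
      show "param (act \<phi> s p) = param (fst (act \<psi> t p) + of_int n, snd (act \<psi> t p))"
        using n by (simp add: param_fst_add_of_int)
    qed
  qed
  have "(0, 0) \<in> blowup points" by (simp add: blowup_def)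
  from *[OF this] show eq: "circle_proj s = circle_proj t"
    by (auto simp: act_def circle_proj_eq_iff)
  assume u: "u \<in> K" and r: "r \<in> {0..1}"
  then obtain v where v: "u = circle_proj v"
    using subgroup.subset[OF subgroup_K] by (auto simp: carrier_circle_group)
  hence "v - s \<in> points" "v \<in> points"
    using u points_add_iff[OF assms(3), of "v - s"] by (auto simp: points_iff)
  \<comment> \<open>This pair is moved into the fibre over \<open>v\<close> by the first action, and
    into that over an integer translate of \<open>v\<close> by the second.\<close>
  hence "(v - s, r) \<in> blowup points" using r by (auto simp: blowup_def)
  moreover have "circle_proj (v - s + t) = circle_proj v"
    using eq Ints_minus[of "s - t"] by (simp add: circle_proj_eq_iff)
  ultimately show "\<phi> u r = \<psi> u r"
    using *[of "(v - s, r)"] \<open>v \<in> points\<close> by (auto simp: act_def v points_iff)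
qed

end

section \<open>Enumeration of the subgroup and the embedding\<close>

lemma countable_subgroup_weights:
  assumes "subgroup K circle_group" and "countable K"
  shows "\<exists>k. wreath_action k K"
proof -
  have K: "K \<noteq> {}" "K \<subseteq> carrier circle_group"
    using subgroup.one_closed[OF assms(1)] subgroup.subset[OF assms(1)] by auto
  \<comment> \<open>\<open>from_nat_into\<close> lists all of a nonempty countable set; if
    \<open>K\<close> is finite, the surplus indices repeat an element.\<close>
  define k where "k n = (SOME x. circle_proj x = from_nat_into K n)" for n
  have "\<exists>x. circle_proj x = from_nat_into K n" for n
    using from_nat_into[OF K(1), of n] K(2) unfolding carrier_circle_group by (metis imageE subsetD)
  hence k: "circle_proj (k n) = from_nat_into K n" for n
    unfolding k_def by (rule someI_ex)
  have "x \<in> circle_weights.points k \<longleftrightarrow> circle_proj x \<in> range (from_nat_into K)" for x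
    by (auto simp: circle_weights.points_def circle_proj_eq_iff simp flip: k)
  hence "wreath_action k K"
    using assms K(1) by (intro wreath_action.intro) (simp_all add: range_from_nat_into)
  thus ?thesis by blast
qed

theorem theorem1p5:
  fixes K :: "real set set" and H\<^sub>0 :: "(real \<Rightarrow> real) set"
  assumes "subgroup K circle_group" and "countable K"
    and "subgroup H\<^sub>0 homeo_plus_interval"
  shows "\<exists>\<Phi>. \<Phi> \<in> mon
      (wreath_product (homeo_plus_interval\<lparr>carrier := H\<^sub>0\<rparr>) (circle_group\<lparr>carrier := K\<rparr>))
      homeo_plus_circle"
proof -
  obtain k where "wreath_action k K" using countable_subgroup_weights[OF assms(1,2)] by blast
  then interpret wreath_action k K .
  let ?W = "wreath_product (homeo_plus_interval\<lparr>carrier := H\<^sub>0\<rparr>) (circle_group\<lparr>carrier := K\<rparr>)"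
  define rep where "rep c = (SOME x. circle_proj x = c)" for c
  define \<Phi> where "\<Phi> = (\<lambda>(\<phi>, c). circle_map (lift \<phi> (rep c)))"
  have rep: "circle_proj (rep c) = c" "rep c \<in> points" if "c \<in> K" for c
  proof -
    have "\<exists>x. circle_proj x = c"
      using that subgroup.subset[OF assms(1)] by (auto simp: carrier_circle_group)
    thus "circle_proj (rep c) = c" unfolding rep_def by (rule someI_ex)
    thus "rep c \<in> points" using that by (simp add: points_iff)
  qed
  have W: "carrier ?W = (K \<rightarrow>\<^sub>E H\<^sub>0) \<times> K"
    by (simp add: wreath_product_def semidirect_product_def)
  have H: "\<phi> \<in> K \<rightarrow> carrier homeo_plus_interval" if "\<phi> \<in> K \<rightarrow>\<^sub>E H\<^sub>0" for \<phi>
    using that subgroup.subset[OF assms(3)] by auto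
  have "\<Phi> \<in> hom ?W homeo_plus_circle"
  proof (rule homI)
    fix a assume "a \<in> carrier ?W"
    thus "\<Phi> a \<in> carrier homeo_plus_circle"
      using circle_map_lift_homeo_plus H rep by (auto simp: W \<Phi>_def)
  next
    fix a b assume "a \<in> carrier ?W" "b \<in> carrier ?W"
    then obtain \<phi> c \<psi> d where a: "a = (\<phi>, c)" "\<phi> \<in> K \<rightarrow>\<^sub>E H\<^sub>0" "c \<in> K"
      and b: "b = (\<psi>, d)" "\<psi> \<in> K \<rightarrow>\<^sub>E H\<^sub>0" "d \<in> K"
      by (auto simp: W)
    \<comment> \<open>The wreath product inverts inside \<open>K\<close>, whereas the computation
      takes place in the whole circle; \<open>m_inv_consistent\<close> identifies the two
      inverses.\<close>
    obtain \<rho> where ab: "a \<otimes>\<^bsub>?W\<^esub> b = (\<rho>, c \<otimes>\<^bsub>circle_group\<^esub> d)"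
      and \<rho>: "\<And>u. u \<in> K \<Longrightarrow> \<rho> u = \<phi> u \<otimes>\<^bsub>homeo_plus_interval\<^esub> \<psi> (inv\<^bsub>circle_group\<^esub> c \<otimes>\<^bsub>circle_group\<^esub> u)"
      using a(3) group.m_inv_consistent[OF group_circle_group assms(1)]
      by (simp add: a(1) b(1) wreath_product_def semidirect_product_def)
    have "\<rho> (circle_proj x) = compose {0..1} (\<phi> (circle_proj x)) (\<psi> (circle_proj (x - rep c)))"
      if x: "x \<in> points" for x
    proof -
      have "x - rep c \<in> points" using points_add[OF x points_minus[OF rep(2)[OF a(3)]]] by simp
      \<comment> \<open>Multiplication in \<open>BijGroup\<close> is restricted to bijections, so it
        unfolds to \<open>compose\<close> only after membership is known.\<close>
      hence "\<phi> (circle_proj x) \<in> Bij {0..1}" "\<psi> (circle_proj (x - rep c)) \<in> Bij {0..1}"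
        using x H[OF a(2)] H[OF b(2)] by (auto simp: points_iff homeo_plus_interval_def)
      moreover have "inv\<^bsub>circle_group\<^esub> c \<otimes>\<^bsub>circle_group\<^esub> circle_proj x = circle_proj (x - rep c)"
        by (subst rep(1)[OF a(3), symmetric]) (simp add: circle_proj_minus circle_proj_add)
      ultimately show ?thesis
        using \<rho>[of "circle_proj x"] x by (simp add: points_iff homeo_plus_interval_def BijGroup_def)
    qed
    hence comp: "lift \<phi> (rep c) \<circ> lift \<psi> (rep d) = lift \<rho> (rep c + rep d)"
      using H[OF b(2)] rep a(3) b(3) by (intro lift_comp)
    \<comment> \<open>The choice \<open>rep\<close> need not be additive; the defect is an integer,
      which \<open>circle_map_lift_cong\<close> absorbs.\<close>
    have "c \<otimes>\<^bsub>circle_group\<^esub> d \<in> K" using subgroup.m_closed[OF assms(1)] a(3) b(3) by blast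
    hence "circle_proj (rep (c \<otimes>\<^bsub>circle_group\<^esub> d)) = circle_proj (rep c + rep d)"
      using rep(1) a(3) b(3) by (simp flip: circle_proj_add)
    hence "\<Phi> (a \<otimes>\<^bsub>?W\<^esub> b) = circle_map (lift \<phi> (rep c) \<circ> lift \<psi> (rep d))"
      unfolding ab \<Phi>_def comp prod.case by (rule circle_map_lift_cong)
    also have "\<dots> = compose (carrier circle_group) (\<Phi> a) (\<Phi> b)"
      by (simp add: circle_map_comp shift_equivariant_lift \<Phi>_def a(1) b(1))
    also have "\<dots> = \<Phi> a \<otimes>\<^bsub>homeo_plus_circle\<^esub> \<Phi> b"
    proof -
      have "\<Phi> a \<in> carrier homeo_plus_circle" "\<Phi> b \<in> carrier homeo_plus_circle"
        using a b circle_map_lift_homeo_plus H rep by (auto simp: \<Phi>_def)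
      thus ?thesis by (simp add: homeo_plus_circle_def BijGroup_def)
    qed
    finally show "\<Phi> (a \<otimes>\<^bsub>?W\<^esub> b) = \<Phi> a \<otimes>\<^bsub>homeo_plus_circle\<^esub> \<Phi> b" .
  qed
  moreover have "inj_on \<Phi> (carrier ?W)"
  proof (rule inj_onI)
    fix a b assume "a \<in> carrier ?W" "b \<in> carrier ?W" and eq: "\<Phi> a = \<Phi> b"
    then obtain \<phi> c \<psi> d where a: "a = (\<phi>, c)" "\<phi> \<in> K \<rightarrow>\<^sub>E H\<^sub>0" "c \<in> K"
      and b: "b = (\<psi>, d)" "\<psi> \<in> K \<rightarrow>\<^sub>E H\<^sub>0" "d \<in> K"
      by (auto simp: W)
    note inj = circle_map_lift_inj[OF H[OF a(2)] H[OF b(2)] rep(2)[OF a(3)] rep(2)[OF b(3)]]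
    have *: "circle_map (lift \<phi> (rep c)) = circle_map (lift \<psi> (rep d))"
      using eq by (simp add: \<Phi>_def a(1) b(1))
    have "c = d" using inj(1)[OF *] rep(1) a(3) b(3) by simp
    moreover have "\<phi> = \<psi>"
    proof (rule PiE_ext[OF a(2) b(2)])
      fix u assume u: "u \<in> K"
      \<comment> \<open>The values are so far compared on the interval only; extensionality settles
        the rest of the line.\<close>
      have "\<phi> u \<in> extensional {0..1}" "\<psi> u \<in> extensional {0..1}"
        using u H[OF a(2)] H[OF b(2)] by (auto simp: homeo_plus_interval_def Bij_def)
      thus "\<phi> u = \<psi> u" using inj(2)[OF * u] by (rule extensionalityI)
    qed
    ultimately show "a = b" by (simp add: a(1) b(1))
  qed
  ultimately show ?thesis by (auto simp: mon_def)
qed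

end
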